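(* For all integers $k,l,m$ with $2\le k<l$ and $m\ge k+l-1$, $r(k,l,m)=k+l+m-2$.
   Context: For a graph whose edges are coloured with red, blue and green, a red (resp. blue, green) $t$-connected matching is a connected component of the spanning subgraph formed by the red (resp. blue, green) edges whose maximum matching has size at least $t$. For positive integers $k,l,m$, $r(k,l,m)$ denotes the smallest integer $n$ such that every red-blue-green colouring of the edges of $K_{n,n}$ contains a red $k$-connected matching, or a blue $l$-connected matching, or a green $m$-connected matching. *)

theory Defs
  imports Main
begin

text \<open>A graph is given by a vertex set \<open>V\<close> and a set \<open>E\<close> of edges, each a two-element subset of \<open>V\<close>.\<close>

definition adjacency :: "'a set set \<Rightarrow> 'a rel" where
  "adjacency E = {(u, v). {u, v} \<in> E}"

text \<open>Connected components are represented by their vertex sets; the edges of a component \<open>C\<close>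
  are the edges of the graph lying inside \<open>C\<close>.\<close>

definition components :: "'a set \<Rightarrow> 'a set set \<Rightarrow> 'a set set" where
  "components V E = V // {(u, v). u \<in> V \<and> v \<in> V \<and> (u, v) \<in> (adjacency E)\<^sup>*}"

definition component_edges :: "'a set set \<Rightarrow> 'a set \<Rightarrow> 'a set set" where
  "component_edges E C = {e \<in> E. e \<subseteq> C}"

definition is_matching :: "'a set set \<Rightarrow> 'a set set \<Rightarrow> bool" where
  "is_matching E M \<longleftrightarrow> M \<subseteq> E \<and> (\<forall>e \<in> M. \<forall>f \<in> M. e \<noteq> f \<longrightarrow> e \<inter> f = {})"

text \<open>Meaningful only for finite edge sets, because of \<open>Max\<close>.\<close>

definition max_matching_size :: "'a set set \<Rightarrow> nat" where
  "max_matching_size E = Max {card M | M. is_matching E M}"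

definition is_connected_matching :: "nat \<Rightarrow> 'a set \<Rightarrow> 'a set set \<Rightarrow> 'a set \<Rightarrow> bool" where
  "is_connected_matching t V E C \<longleftrightarrow>
     C \<in> components V E \<and> max_matching_size (component_edges E C) \<ge> t"

text \<open>The two sides of \<open>K\<^sub>n\<^sub>,\<^sub>n\<close> are the left and right copies of \<open>{0,\<dots>,n-1}\<close>.\<close>

definition knn_verts :: "nat \<Rightarrow> (nat + nat) set" where
  "knn_verts n = Inl ` {..<n} \<union> Inr ` {..<n}"

definition knn_edges :: "nat \<Rightarrow> (nat + nat) set set" where
  "knn_edges n = {{Inl i, Inr j} | i j. i < n \<and> j < n}"

datatype colour = Red | Blue | Green

text \<open>Colourings are total functions on sets of vertices; only their values on \<open>knn_edges n\<close>
  are ever used.\<close>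

definition colour_class :: "nat \<Rightarrow> ((nat + nat) set \<Rightarrow> colour) \<Rightarrow> colour \<Rightarrow> (nat + nat) set set" where
  "colour_class n c x = {e \<in> knn_edges n. c e = x}"

definition has_mono_connected_matching ::
    "nat \<Rightarrow> ((nat + nat) set \<Rightarrow> colour) \<Rightarrow> colour \<Rightarrow> nat \<Rightarrow> bool" where
  "has_mono_connected_matching n c x t \<longleftrightarrow>
     (\<exists>C. is_connected_matching t (knn_verts n) (colour_class n c x) C)"

definition ramsey_connected_matching :: "nat \<Rightarrow> nat \<Rightarrow> nat \<Rightarrow> nat" where
  "ramsey_connected_matching k l m = (LEAST n. \<forall>c :: (nat + nat) set \<Rightarrow> colour.
     has_mono_connected_matching n c Red k \<or>
     has_mono_connected_matching n c Blue l \<or>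
     has_mono_connected_matching n c Green m)"

end

theory Submission imports Defs begin

text \<open>Put \<open>a = k - 1\<close>, \<open>b = l - 1\<close>, \<open>c = m - 1\<close>, \<open>n = a + b + c + 1\<close>, and suppose that every red,
  blue, green component of \<open>K\<^sub>n\<^sub>,\<^sub>n\<close> has matching number at most \<open>a\<close>, \<open>b\<close>, \<open>c\<close>. By Koenig's theorem a red
  component contains at most \<open>a\<close> vertices of red degree exceeding \<open>a\<close> (red-heavy vertices), and likewise
  for blue. A vertex with more than \<open>a + b\<close> red or blue neighbours is red-heavy or blue-heavy. Counting
  heavy vertices shows: if all edges between \<open>A\<close> and \<open>Z\<close> are red or blue, where \<open>|Z| > a + b\<close> and \<open>Z\<close>
  consists of heavy vertices, then \<open>|A| + |Z| \<le> 2a + 2b\<close>, or \<open>A\<close> consists of red-heavy vertices of one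
  red component, or of blue-heavy vertices of one blue component.

  Call a union of green components small if it has at most \<open>a + b\<close> vertices on each side. There are no
  green edges between such a union and its complement, so one of the two is small. Either one green
  component has a small complement, and removing a cover of size at most \<open>c\<close> from it leaves a red-blue
  blow-up of a path on four vertices; or the vertices split into three small unions, which gives a
  red-blue blow-up of a hexagon. The counting statement excludes both.\<close>

section \<open>Koenig's theorem for bipartite graphs\<close>

text \<open>Uncrossing \<open>C\<close> and \<open>D\<close> into \<open>P\<close> and
  \<open>Q\<close> keeps the total size at most \<open>2 * t - 2\<close>. Yet \<open>P\<close>
  covers all of \<open>E\<close>, and so does \<open>Q\<close> once \<open>v\<close> is added, which
  needs a total of at least \<open>2 * t - 1\<close>.\<close>

lemma koenig_uncross:
  fixes E :: "'v set set"
  assumes bip: "\<And>e. e \<in> E \<Longrightarrow> \<exists>x y. e = {x, y} \<and> x \<in> X \<and> y \<notin> X"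
    and tau: "\<And>W. finite W \<Longrightarrow> (\<And>e. e \<in> E \<Longrightarrow> e \<inter> W \<noteq> {}) \<Longrightarrow> t \<le> card W"
    and e: "e \<in> E" and f: "f \<in> E" and "e \<noteq> f" and v: "v \<in> e" "v \<in> f" "v \<in> X"
    and C: "finite C" "card C < t" "\<forall>g\<in>E - {e}. g \<inter> C \<noteq> {}"
    and D: "finite D" "card D < t" "\<forall>g\<in>E - {f}. g \<inter> D \<noteq> {}"
  shows False
proof -
  have eC: "e \<inter> C = {}"
  proof (rule ccontr)
    assume *: "e \<inter> C \<noteq> {}"
    have "t \<le> card C"
      by (rule tau[OF C(1)]) (use * C(3) in blast)
    then show False using C(2) by simp
  qed
  have fD: "f \<inter> D = {}"
  proof (rule ccontr)
    assume *: "f \<inter> D \<noteq> {}"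
    have "t \<le> card D"
      by (rule tau[OF D(1)]) (use * D(3) in blast)
    then show False using D(2) by simp
  qed
  define P where "P = (C \<inter> D \<inter> X) \<union> ((C \<union> D) - X)"
  define Q where "Q = ((C \<union> D) \<inter> X) \<union> (C \<inter> D - X)"
  have fin: "finite P" "finite Q" using C(1) D(1) by (auto simp: P_def Q_def)
  have "P \<union> Q = C \<union> D" "P \<inter> Q = C \<inter> D" by (auto simp: P_def Q_def)
  then have sum: "card P + card Q = card C + card D"
    using card_Un_Int[OF fin] card_Un_Int[OF C(1) D(1)] by simp
  have "t \<le> card P"
  proof (rule tau[OF fin(1)])
    fix g assume g: "g \<in> E"
    then obtain x y where xy: "g = {x, y}" "x \<in> X" "y \<notin> X" using bip by blast
    have gC: "x \<in> C \<or> y \<in> C" if "g \<noteq> e"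
      using bspec[OF C(3), of g] g that unfolding xy(1) by blast
    have gD: "x \<in> D \<or> y \<in> D" if "g \<noteq> f"
      using bspec[OF D(3), of g] g that unfolding xy(1) by blast
    \<comment> \<open>Avoiding \<open>v\<close>, the set \<open>D\<close> must meet
      \<open>e\<close>, and \<open>C\<close> must meet \<open>f\<close>, at the end outside
      \<open>X\<close>; \<open>P\<close> keeps all such ends.\<close>
    have "v \<notin> C" "v \<notin> D" using v eC fD by blast+
    moreover have "x = v" if "g = e \<or> g = f" using that xy v by auto
    ultimately have "x \<in> C \<and> x \<in> D \<or> y \<in> C \<or> y \<in> D"
      using gC gD \<open>e \<noteq> f\<close> by metis
    then show "g \<inter> P \<noteq> {}" using xy by (auto simp: P_def)
  qed
  moreover have "t \<le> card (insert v Q)"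
  proof (rule tau)
    fix g assume g: "g \<in> E"
    then obtain x y where xy: "g = {x, y}" "x \<in> X" "y \<notin> X" using bip by blast
    show "g \<inter> insert v Q \<noteq> {}"
    proof (cases "g = e \<or> g = f")
      case True
      then show ?thesis using v by auto
    next
      case False
      then have "x \<in> C \<or> y \<in> C" "x \<in> D \<or> y \<in> D"
        using bspec[OF C(3), of g] bspec[OF D(3), of g] g unfolding xy(1) by blast+
      then show ?thesis using xy by (auto simp: Q_def)
    qed
  qed (use fin in simp)
  moreover have "card (insert v Q) \<le> Suc (card Q)" by (rule card_insert_le_m1) auto
  ultimately show False using sum C(2) D(2) by linarith
qed

text \<open>Lovasz's argument for Koenig's theorem: a graph that is edge-minimal for its covering number
  is a matching, since otherwise the covers of two edge-deleted subgraphs can be uncrossed.\<close>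

lemma koenig:
  fixes E :: "'v set set"
  assumes "finite E"
    and "\<And>e. e \<in> E \<Longrightarrow> \<exists>x y. e = {x, y} \<and> x \<in> X \<and> y \<notin> X"
    and "\<And>W. finite W \<Longrightarrow> (\<And>e. e \<in> E \<Longrightarrow> e \<inter> W \<noteq> {}) \<Longrightarrow> t \<le> card W"
  shows "\<exists>M. is_matching E M \<and> t \<le> card M"
  using assms
proof (induction E rule: finite_psubset_induct)
  case (psubset E)
  note bip = psubset.prems(1) and tau = psubset.prems(2)
  show ?case
  proof (cases "\<exists>e\<in>E. \<forall>W. finite W \<longrightarrow> (\<forall>g\<in>E - {e}. g \<inter> W \<noteq> {}) \<longrightarrow> t \<le> card W")
    case True
    then obtain e where e: "e \<in> E"
      "\<forall>W. finite W \<longrightarrow> (\<forall>g\<in>E - {e}. g \<inter> W \<noteq> {}) \<longrightarrow> t \<le> card W" by (rule bexE)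
    have "\<exists>M. is_matching (E - {e}) M \<and> t \<le> card M"
    proof (rule psubset.IH)
      show "E - {e} \<subset> E" using e(1) by blast
      show "\<exists>x y. g = {x, y} \<and> x \<in> X \<and> y \<notin> X" if "g \<in> E - {e}" for g
        by (rule bip) (use that in blast)
      show "t \<le> card W" if "finite W" "\<And>g. g \<in> E - {e} \<Longrightarrow> g \<inter> W \<noteq> {}" for W
        using e(2) that by simp
    qed
    then obtain M where "is_matching (E - {e}) M" "t \<le> card M" by (elim exE conjE)
    then have "is_matching E M" "t \<le> card M" by (auto simp: is_matching_def)
    then show ?thesis by (intro exI conjI)
  next
    case False
    have crit: "\<exists>W. finite W \<and> card W < t \<and> (\<forall>g\<in>E - {e}. g \<inter> W \<noteq> {})"
      if "e \<in> E" for e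
    proof (rule ccontr)
      assume *: "\<not> ?thesis"
      have "\<forall>W. finite W \<longrightarrow> (\<forall>g\<in>E - {e}. g \<inter> W \<noteq> {}) \<longrightarrow> t \<le> card W"
      proof (intro allI impI, rule ccontr)
        fix W assume "finite W" "\<forall>g\<in>E - {e}. g \<inter> W \<noteq> {}" "\<not> t \<le> card W"
        then have "finite W \<and> card W < t \<and> (\<forall>g\<in>E - {e}. g \<inter> W \<noteq> {})"
          by (intro conjI) (simp_all only: not_le)
        then show False by (rule notE[OF * exI])
      qed
      then show False by (rule notE[OF False bexI[OF _ that]])
    qed
    have "e \<inter> f = {}" if ef: "e \<in> E" "f \<in> E" "e \<noteq> f" for e f
    proof (rule ccontr)
      assume "e \<inter> f \<noteq> {}"
      then obtain v where v: "v \<in> e" "v \<in> f" by auto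
      obtain C where C: "finite C" "card C < t" "\<forall>g\<in>E - {e}. g \<inter> C \<noteq> {}"
        using crit[OF ef(1)] by (elim exE conjE) (rule that)
      obtain D where D: "finite D" "card D < t" "\<forall>g\<in>E - {f}. g \<inter> D \<noteq> {}"
        using crit[OF ef(2)] by (elim exE conjE) (rule that)
      \<comment> \<open>Complementing \<open>X\<close> exchanges the sides, so uncrossing also
        applies at a vertex outside \<open>X\<close>.\<close>
      have bip': "\<exists>x y. g = {x, y} \<and> x \<in> - X \<and> y \<notin> - X" if "g \<in> E" for g
        using bip[OF that] by (metis Compl_iff insert_commute)
      show False
      proof (cases "v \<in> X")
        case True
        show ?thesis by (rule koenig_uncross[OF bip tau ef v True C D])
      next
        case False
        then have "v \<in> - X" by simp
        show ?thesis by (rule koenig_uncross[OF bip' tau ef v \<open>v \<in> - X\<close> C D])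
      qed
    qed
    then have M: "is_matching E E" by (auto simp: is_matching_def)
    \<comment> \<open>One end chosen from each edge gives a cover with at most \<open>card E\<close>
      elements.\<close>
    have "t \<le> card ((\<lambda>e. SOME v. v \<in> e) ` E)"
    proof (rule tau)
      fix e assume "e \<in> E"
      then have "(SOME v. v \<in> e) \<in> e" using bip[of e] someI[of "\<lambda>v. v \<in> e"] by blast
      then show "e \<inter> (\<lambda>e. SOME v. v \<in> e) ` E \<noteq> {}" using \<open>e \<in> E\<close> by auto
    qed (use psubset.hyps in simp)
    also have "\<dots> \<le> card E" using psubset.hyps by (rule card_image_le)
    finally show ?thesis using M by blast
  qed
qed

section \<open>Counting tools\<close>

lemma card_le_by_fibres:
  assumes "finite S" "finite T"
    and "\<And>k. k \<in> f ` S \<Longrightarrow> card {x \<in> S. f x = k} \<le> card {x \<in> T. f x = k}"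
  shows "card S \<le> card T"
proof -
  have "card S = (\<Sum>k\<in>f ` S. card {x \<in> S. f x = k})"
    using sum.group[of S "f ` S" f "\<lambda>_. 1::nat"] assms(1) by simp
  also have "\<dots> \<le> (\<Sum>k\<in>f ` S. card {x \<in> T. f x = k})" by (rule sum_mono) (rule assms(3))
  also have "\<dots> = card (\<Union>k\<in>f ` S. {x \<in> T. f x = k})"
    by (rule card_UN_disjoint[symmetric]) (use assms in auto)
  also have "\<dots> \<le> card T" by (rule card_mono) (use assms in auto)
  finally show ?thesis .
qed

lemma card_le_Un4:
  assumes "S \<subseteq> A \<union> B \<union> C \<union> D" "finite A" "finite B" "finite C" "finite D"
  shows "card S \<le> card A + card B + card C + card D"
proof -
  have "card S \<le> card (A \<union> B \<union> C \<union> D)" using assms by (intro card_mono) auto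
  also have "\<dots> \<le> card (A \<union> B \<union> C) + card D" by (rule card_Un_le)
  also have "\<dots> \<le> card (A \<union> B) + card C + card D" by (simp add: card_Un_le)
  also have "\<dots> \<le> card A + card B + card C + card D" by (simp add: card_Un_le)
  finally show ?thesis .
qed

section \<open>Heavy vertices in a graph whose components have small covers\<close>

text \<open>The function \<open>lab\<close> names the component of a vertex. Vertices of degree more than \<open>s\<close> lie in
  every cover of size at most \<open>s\<close> of their component.\<close>

locale covered_graph =
  fixes V :: "'v set" and adj :: "'v \<Rightarrow> 'v \<Rightarrow> bool" and lab :: "'v \<Rightarrow> 'k" and s :: nat
  assumes finite_verts: "finite V"
    and adj_sym: "adj u v \<Longrightarrow> adj v u"
    and adj_lab: "adj u v \<Longrightarrow> lab u = lab v"
    and cover: "\<exists>W. finite W \<and> card W \<le> s \<and>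
      (\<forall>u\<in>V. \<forall>v\<in>V. adj u v \<longrightarrow> lab u = k \<longrightarrow> u \<in> W \<or> v \<in> W)"
begin

definition heavy :: "'v set" where
  "heavy = {v \<in> V. s < card {u \<in> V. adj v u}}"

definition heavy_in :: "'k \<Rightarrow> 'v set" where
  "heavy_in k = {v \<in> heavy. lab v = k}"

lemma finite_heavy_in: "finite (heavy_in k)"
  using finite_verts by (simp add: heavy_in_def heavy_def)

lemma card_heavy_in: "card (heavy_in k) \<le> s"
proof -
  obtain W where W: "finite W" "card W \<le> s"
    and cov: "\<forall>u\<in>V. \<forall>v\<in>V. adj u v \<longrightarrow> lab u = k \<longrightarrow> u \<in> W \<or> v \<in> W"
    using cover[of k] by (elim exE conjE) (rule that)
  have "heavy_in k \<subseteq> W"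
  proof (rule subsetI, rule ccontr)
    fix v assume "v \<in> heavy_in k" and W': "v \<notin> W"
    then have v: "v \<in> V" "lab v = k" "s < card {u \<in> V. adj v u}"
      by (auto simp: heavy_in_def heavy_def)
    have "{u \<in> V. adj v u} \<subseteq> W" using bspec[OF cov v(1)] v(2) W' by blast
    then have "card {u \<in> V. adj v u} \<le> card W" by (rule card_mono[OF W(1)])
    then show False using v W by linarith
  qed
  then have "card (heavy_in k) \<le> card W" by (rule card_mono[OF W(1)])
  then show ?thesis using W by linarith
qed

lemma card_subset_heavy_in: "A \<subseteq> heavy_in k \<Longrightarrow> card A \<le> s"
  by (rule le_trans[OF card_mono[OF finite_heavy_in] card_heavy_in])

lemma heavyI:
  assumes "v \<in> V" "Z \<subseteq> V" "s < card Z" "\<And>z. z \<in> Z \<Longrightarrow> adj v z"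
  shows "v \<in> heavy"
proof -
  have "card Z \<le> card {u \<in> V. adj v u}"
    by (rule card_mono) (use assms finite_verts in auto)
  then show ?thesis using assms unfolding heavy_def by simp
qed

lemma card_le_if_not_heavy:
  assumes "v \<in> V" "v \<notin> heavy" "Z \<subseteq> V" "\<And>z. z \<in> Z \<Longrightarrow> adj v z"
  shows "card Z \<le> s"
proof (rule ccontr)
  assume "\<not> card Z \<le> s"
  then have "v \<in> heavy" using heavyI[of v Z] assms by simp
  then show False using assms by simp
qed

end

section \<open>Two colours: the counting statement\<close>

locale two_covered_graphs =
  R: covered_graph V red \<rho> a + B: covered_graph V blue \<sigma> b
  for V :: "'v set" and red blue :: "'v \<Rightarrow> 'v \<Rightarrow> bool" and \<rho> \<sigma> :: "'v \<Rightarrow> 'k" and a b :: nat +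
  assumes a_le_b: "a \<le> b"
begin

definition joined :: "'v set \<Rightarrow> 'v set \<Rightarrow> bool" where
  "joined A Z \<longleftrightarrow> (\<forall>x\<in>A. \<forall>z\<in>Z. red x z \<or> blue x z)"

text \<open>The exceptional alternative of the counting statement.\<close>

definition mono_set :: "'v set \<Rightarrow> bool" where
  "mono_set A \<longleftrightarrow> (\<exists>k. A \<subseteq> R.heavy_in k) \<or> (\<exists>k. A \<subseteq> B.heavy_in k)"

lemma joined_sym: "joined A Z \<Longrightarrow> joined Z A"
  unfolding joined_def using R.adj_sym B.adj_sym by blast

lemma card_mono_set: "mono_set A \<Longrightarrow> card A \<le> b"
  unfolding mono_set_def
  by (elim disjE exE) (use a_le_b in \<open>auto dest!: R.card_subset_heavy_in B.card_subset_heavy_in\<close>)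

lemma heavy_if_joined:
  assumes "A \<subseteq> V" "Z \<subseteq> V" "joined A Z" "a + b < card Z"
  shows "A \<subseteq> R.heavy \<union> B.heavy"
proof (rule subsetI, rule ccontr)
  fix x assume x: "x \<in> A" "x \<notin> R.heavy \<union> B.heavy"
  have "card {z \<in> Z. red x z} \<le> a"
    by (rule R.card_le_if_not_heavy[of x]) (use x assms in auto)
  moreover have "card {z \<in> Z. blue x z} \<le> b"
    by (rule B.card_le_if_not_heavy[of x]) (use x assms in auto)
  moreover have "Z = {z \<in> Z. red x z} \<union> {z \<in> Z. blue x z}"
    using assms(3) x by (auto simp: joined_def)
  then have "card Z \<le> card {z \<in> Z. red x z} + card {z \<in> Z. blue x z}"
    by (metis card_Un_le)
  ultimately show False using assms(4) by linarith
qed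

context
  fixes A Z :: "'v set"
  assumes AV: "A \<subseteq> V" and ZV: "Z \<subseteq> V" and AZ: "joined A Z" and Z: "a + b < card Z"
    and Zh: "Z \<subseteq> R.heavy \<union> B.heavy"
begin

lemma finite_Z: "finite Z" using ZV R.finite_verts finite_subset by blast
lemma finite_A: "finite A" using AV R.finite_verts finite_subset by blast

lemma same_lab: "x \<in> A \<Longrightarrow> z \<in> Z \<Longrightarrow> \<rho> x = \<rho> z \<or> \<sigma> x = \<sigma> z"
  using AZ R.adj_lab[of x z] B.adj_lab[of x z] unfolding joined_def by blast

lemma all_heavy: "v \<in> A \<union> Z \<Longrightarrow> v \<in> R.heavy \<or> v \<in> B.heavy"
  using heavy_if_joined[OF AV ZV AZ Z] Zh by blast

text \<open>All vertices of \<open>Z\<close> outside the red component of \<open>x\<close> are blue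
  neighbours of \<open>x\<close>, and \<open>x\<close> has at most \<open>b\<close> of
  those.\<close>

lemma few_other_red:
  assumes "x \<in> A" "x \<notin> B.heavy"
  shows "card {z \<in> Z. \<rho> z \<noteq> \<rho> x} \<le> b"
proof (rule B.card_le_if_not_heavy[of x])
  fix z assume "z \<in> {z \<in> Z. \<rho> z \<noteq> \<rho> x}"
  then show "blue x z" using assms AZ R.adj_lab[of x z] unfolding joined_def by fastforce
qed (use assms AV ZV in auto)

lemma few_other_blue:
  assumes "x \<in> A" "x \<notin> R.heavy"
  shows "card {z \<in> Z. \<sigma> z \<noteq> \<sigma> x} \<le> a"
proof (rule R.card_le_if_not_heavy[of x])
  fix z assume "z \<in> {z \<in> Z. \<sigma> z \<noteq> \<sigma> x}"
  then show "red x z" using assms AZ B.adj_lab[of x z] unfolding joined_def by fastforce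
qed (use assms AV ZV in auto)

text \<open>Two exclusions of total size at most \<open>a + b\<close> cannot exhaust
  \<open>Z\<close>. This supplies vertices of \<open>Z\<close> in prescribed components.\<close>

lemma ex_avoiding:
  assumes "card {z \<in> Z. P z} \<le> p" "card {z \<in> Z. Q z} \<le> q" "p + q \<le> a + b"
  shows "\<exists>z\<in>Z. \<not> P z \<and> \<not> Q z"
proof (rule ccontr)
  assume "\<not> ?thesis"
  then have "Z = {z \<in> Z. P z} \<union> {z \<in> Z. Q z}" by auto
  then have "card Z \<le> card {z \<in> Z. P z} + card {z \<in> Z. Q z}" by (metis card_Un_le)
  then show False using assms Z by linarith
qed

lemma ex_avoiding1: "card {z \<in> Z. P z} \<le> p \<Longrightarrow> p \<le> a + b \<Longrightarrow> \<exists>z\<in>Z. \<not> P z"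
  using ex_avoiding[of P p "\<lambda>_. False" 0] by auto

text \<open>Each of \<open>x\<close> and \<open>y\<close> excludes at most \<open>a\<close> vertices
  of \<open>Z\<close>, and \<open>2 * a \<le> a + b\<close>, so some vertex of \<open>Z\<close>
  shares a blue component with both. With colours exchanged this argument would require
  \<open>2 * b \<le> a + b\<close>, so the cases below are not mirror images.\<close>

lemma not_red_heavy_same_blue:
  assumes "x \<in> A" "y \<in> A" "x \<notin> R.heavy" "y \<notin> R.heavy"
  shows "\<sigma> x = \<sigma> y"
  using ex_avoiding[OF few_other_blue[of x] few_other_blue[of y]] assms a_le_b by force

text \<open>In each red component other than that of \<open>x\<close>, the vertices counted here are either all in \<open>Z\<close>,
  or there are at most \<open>a\<close> of them while the component contains more than \<open>a\<close> vertices of \<open>Z\<close>.\<close>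

lemma card_other_red_heavy:
  assumes x: "x \<in> A" "x \<notin> B.heavy"
  shows "card {v \<in> A \<union> Z. v \<in> R.heavy \<and> v \<notin> B.heavy \<and> \<rho> v \<noteq> \<rho> x} \<le> b" (is "card ?T \<le> b")
proof -
  have "card ?T \<le> card {z \<in> Z. \<rho> z \<noteq> \<rho> x}"
  proof (rule card_le_by_fibres[where f = \<rho>])
    fix k assume k: "k \<in> \<rho> ` ?T"
    then have "k \<noteq> \<rho> x" by auto
    then have eq: "{v \<in> {z \<in> Z. \<rho> z \<noteq> \<rho> x}. \<rho> v = k} = {z \<in> Z. \<rho> z = k}" by auto
    show "card {v \<in> ?T. \<rho> v = k} \<le> card {v \<in> {z \<in> Z. \<rho> z \<noteq> \<rho> x}. \<rho> v = k}"
    proof (cases "{v \<in> ?T. \<rho> v = k} \<subseteq> Z")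
      case True
      then show ?thesis unfolding eq by (intro card_mono) (use finite_Z in auto)
    next
      case False
      then obtain w where w: "w \<in> A" "w \<notin> B.heavy" "\<rho> w = k" by auto
      have "Z = {z \<in> Z. \<rho> z \<noteq> \<rho> w} \<union> {z \<in> Z. \<rho> z = k}" using w by auto
      then have "card Z \<le> card {z \<in> Z. \<rho> z \<noteq> \<rho> w} + card {z \<in> Z. \<rho> z = k}"
        by (metis card_Un_le)
      then have "a < card {z \<in> Z. \<rho> z = k}" using few_other_red[OF w(1,2)] Z by linarith
      moreover have "card {v \<in> ?T. \<rho> v = k} \<le> a"
        by (rule R.card_subset_heavy_in[of _ k]) (auto simp: R.heavy_in_def)
      ultimately show ?thesis unfolding eq by linarith
    qed
  qed (use finite_A finite_Z in auto)
  then show ?thesis using few_other_red[OF x] by linarith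
qed

text \<open>One heavy set of each colour accounts for \<open>a + b\<close> vertices, which leaves
  room for \<open>a + b\<close> others. Every case below ends with such a cover.\<close>

lemma card_le_by_heavy:
  assumes "A \<union> Z \<subseteq> R.heavy_in k \<union> B.heavy_in j \<union> C \<union> D" "finite C" "finite D"
    "card C \<le> p" "card D \<le> q" "p + q \<le> a + b"
  shows "card (A \<union> Z) \<le> 2 * a + 2 * b"
  using card_le_Un4[OF assms(1) R.finite_heavy_in B.finite_heavy_in assms(2,3)]
    R.card_heavy_in[of k] B.card_heavy_in[of j] assms(4-6) by linarith

lemma card_le_mixed:
  assumes x: "x \<in> A" "x \<notin> B.heavy" and y: "y \<in> A" "y \<notin> R.heavy"
  shows "card (A \<union> Z) \<le> 2 * a + 2 * b"
proof (rule card_le_by_heavy[where p = a and q = b])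
  let ?T = "{v \<in> A \<union> Z. v \<in> R.heavy \<and> v \<notin> B.heavy \<and> \<rho> v \<noteq> \<rho> x}"
  let ?C = "{z \<in> Z. \<sigma> z \<noteq> \<sigma> y}"
  \<comment> \<open>This \<open>z\<close> ties each vertex of \<open>A\<close> to the red component
    of \<open>x\<close> or the blue component of \<open>y\<close>.\<close>
  obtain z where z: "z \<in> Z" "\<rho> z = \<rho> x" "\<sigma> z = \<sigma> y"
    using ex_avoiding[OF few_other_red[OF x] few_other_blue[OF y]] by auto
  show "A \<union> Z \<subseteq> R.heavy_in (\<rho> x) \<union> B.heavy_in (\<sigma> y) \<union> ?C \<union> ?T"
  proof
    fix v assume v: "v \<in> A \<union> Z"
    show "v \<in> R.heavy_in (\<rho> x) \<union> B.heavy_in (\<sigma> y) \<union> ?C \<union> ?T"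
    proof (cases "v \<in> Z")
      case True
      then show ?thesis using all_heavy[OF v] by (auto simp: R.heavy_in_def B.heavy_in_def)
    next
      case False
      then have "v \<in> A" using v by simp
      then show ?thesis
        using all_heavy[OF v] same_lab[OF _ z(1), of v] z not_red_heavy_same_blue[of v y] y
        by (auto simp: R.heavy_in_def B.heavy_in_def)
    qed
  qed
  show "card ?C \<le> a" "card ?T \<le> b" using few_other_blue[OF y] card_other_red_heavy[OF x] by auto
qed (use finite_A finite_Z in auto)

text \<open>Since \<open>w\<close> avoids the blue component of \<open>y\<close>, the vertices of
  \<open>Z\<close> in that component all lie in the red component of \<open>w\<close>; at most
  \<open>a\<close> vertices of \<open>Z\<close> lie elsewhere.\<close>

lemma card_le_not_red_heavy:
  assumes AB: "A \<subseteq> B.heavy" and y: "y \<in> A" "y \<notin> R.heavy" and w: "w \<in> A" "\<sigma> w \<noteq> \<sigma> y"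
  shows "card (A \<union> Z) \<le> 2 * a + 2 * b"
proof (rule card_le_by_heavy[where p = a and q = 0])
  let ?C = "{z \<in> Z. \<sigma> z \<noteq> \<sigma> y}"
  obtain z where z: "z \<in> Z" "\<sigma> z = \<sigma> y"
    using ex_avoiding1[OF few_other_blue[OF y]] by auto
  have wz: "\<rho> w = \<rho> z" using same_lab[OF w(1) z(1)] z w by auto
  show "A \<union> Z \<subseteq> R.heavy_in (\<rho> w) \<union> B.heavy_in (\<sigma> y) \<union> ?C \<union> {}"
  proof
    fix v assume v: "v \<in> A \<union> Z"
    show "v \<in> R.heavy_in (\<rho> w) \<union> B.heavy_in (\<sigma> y) \<union> ?C \<union> {}"
    proof (cases "v \<in> Z")
      case True
      then show ?thesis using all_heavy[OF v] same_lab[OF w(1) True] w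
        by (auto simp: R.heavy_in_def B.heavy_in_def)
    next
      case False
      then have "v \<in> A" using v by simp
      then show ?thesis
        using AB same_lab[OF _ z(1), of v] z wz not_red_heavy_same_blue[of v y] y
        by (auto simp: R.heavy_in_def B.heavy_in_def)
    qed
  qed
  show "card ?C \<le> a" using few_other_blue[OF y] by auto
qed (use finite_Z in auto)

text \<open>The red component of \<open>x\<close> splits \<open>Z\<close>: inside it the blue label
  is that of \<open>w\<close>, outside it that of \<open>x\<close>. The cover depends on whether
  these labels agree and whether the outside part is empty.\<close>

lemma card_le_not_blue_heavy:
  assumes AR: "A \<subseteq> R.heavy" and x: "x \<in> A" "x \<notin> B.heavy" and w: "w \<in> A" "\<rho> w \<noteq> \<rho> x"
  shows "card (A \<union> Z) \<le> 2 * a + 2 * b"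
proof -
  obtain z where z: "z \<in> Z" "\<rho> z = \<rho> x"
    using ex_avoiding1[OF few_other_red[OF x]] by auto
  have Zw: "\<sigma> v = \<sigma> w" if "v \<in> Z" "\<rho> v = \<rho> x" for v
    using same_lab[OF w(1) that(1)] that w by auto
  have Aw: "\<sigma> v = \<sigma> w" if "v \<in> A" "\<rho> v \<noteq> \<rho> x" for v
    using same_lab[OF that(1) z(1)] that z Zw[OF z] by auto
  have Zx: "\<sigma> v = \<sigma> x" if "v \<in> Z" "\<rho> v \<noteq> \<rho> x" for v
    using same_lab[OF x(1) that(1)] that by auto
  show ?thesis
  proof (cases "\<sigma> x = \<sigma> w")
    case True
    let ?T = "{v \<in> A \<union> Z. v \<in> R.heavy \<and> v \<notin> B.heavy \<and> \<rho> v \<noteq> \<rho> x}"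
    show ?thesis
    proof (rule card_le_by_heavy[where p = 0 and q = b])
      show "A \<union> Z \<subseteq> R.heavy_in (\<rho> x) \<union> B.heavy_in (\<sigma> x) \<union> {} \<union> ?T" (is "_ \<subseteq> ?U")
      proof
        fix v assume v: "v \<in> A \<union> Z"
        show "v \<in> ?U" using v all_heavy[OF v] AR Zw[of v] Aw[of v] Zx[of v] True
          by (auto simp: R.heavy_in_def B.heavy_in_def)
      qed
      show "card ?T \<le> b" using card_other_red_heavy[OF x] .
    qed (use finite_A finite_Z in auto)
  next
    case xw: False
    show ?thesis
    proof (cases "\<exists>z1\<in>Z. \<rho> z1 \<noteq> \<rho> x")
      case True
      then obtain z1 where z1: "z1 \<in> Z" "\<rho> z1 \<noteq> \<rho> x" by auto
      have A1: "\<rho> v = \<rho> z1" if "v \<in> A" "\<rho> v \<noteq> \<rho> x" for v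
        using same_lab[OF that(1) z1(1)] Zx[OF z1] Aw[OF that] xw by auto
      have Z1: "\<rho> v = \<rho> z1" if "v \<in> Z" "\<rho> v \<noteq> \<rho> x" for v
        using same_lab[OF w(1) that(1)] Zx[OF that] A1[OF w] xw by auto
      show ?thesis
      proof (rule card_le_by_heavy[where p = a and q = b])
        show "A \<union> Z \<subseteq> R.heavy_in (\<rho> x) \<union> B.heavy_in (\<sigma> w) \<union> R.heavy_in (\<rho> z1) \<union> B.heavy_in (\<sigma> x)"
          (is "_ \<subseteq> ?U")
      proof
        fix v assume v: "v \<in> A \<union> Z"
        show "v \<in> ?U" using v all_heavy[OF v] AR Zw[of v] Zx[of v] A1[of v] Z1[of v]
          by (auto simp: R.heavy_in_def B.heavy_in_def)
      qed
      qed (use R.finite_heavy_in B.finite_heavy_in R.card_heavy_in B.card_heavy_in in simp_all)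
    next
      case False
      \<comment> \<open>Otherwise \<open>v\<close> would share its red component with some vertex of
        \<open>Z\<close>, but \<open>Z\<close> lies in that of \<open>x\<close>.\<close>
      have Ab: "v \<in> B.heavy" if "v \<in> A" "\<rho> v \<noteq> \<rho> x" for v
        using ex_avoiding1[OF few_other_red[of v]] that False by fastforce
      show ?thesis
      proof (rule card_le_by_heavy[where p = 0 and q = 0])
        show "A \<union> Z \<subseteq> R.heavy_in (\<rho> x) \<union> B.heavy_in (\<sigma> w) \<union> {} \<union> {}" (is "_ \<subseteq> ?U")
      proof
        fix v assume v: "v \<in> A \<union> Z"
        show "v \<in> ?U" using v all_heavy[OF v] AR Zw[of v] Aw[of v] Ab[of v] False
          by (auto simp: R.heavy_in_def B.heavy_in_def)
      qed
      qed auto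
    qed
  qed
qed

text \<open>As \<open>x\<close> and \<open>y\<close> differ in red, each vertex of \<open>Z\<close>
  has the blue label of \<open>x\<close> or \<open>y\<close>; likewise it has the red label of
  \<open>x\<close> or \<open>w\<close>. The four heavy sets also contain \<open>A\<close>, whose
  vertices are heavy in both colours and share a label with any vertex of \<open>Z\<close>.\<close>

lemma card_le_both_heavy:
  assumes AR: "A \<subseteq> R.heavy" and AB: "A \<subseteq> B.heavy" and x: "x \<in> A"
    and y: "y \<in> A" "\<rho> y \<noteq> \<rho> x" and w: "w \<in> A" "\<sigma> w \<noteq> \<sigma> x"
  shows "card (A \<union> Z) \<le> 2 * a + 2 * b"
proof (rule card_le_by_heavy[where p = a and q = b])
  have Zs: "\<sigma> z = \<sigma> x \<or> \<sigma> z = \<sigma> y" if "z \<in> Z" for z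
    using same_lab[OF x that] same_lab[OF y(1) that] y by auto
  have Zr: "\<rho> z = \<rho> x \<or> \<rho> z = \<rho> w" if "z \<in> Z" for z
    using same_lab[OF x that] same_lab[OF w(1) that] w by auto
  obtain z where z: "z \<in> Z" using Z by fastforce
  show "A \<union> Z \<subseteq> R.heavy_in (\<rho> x) \<union> B.heavy_in (\<sigma> x) \<union> R.heavy_in (\<rho> w) \<union> B.heavy_in (\<sigma> y)"
  proof
    fix v assume v: "v \<in> A \<union> Z"
    show "v \<in> R.heavy_in (\<rho> x) \<union> B.heavy_in (\<sigma> x) \<union> R.heavy_in (\<rho> w) \<union> B.heavy_in (\<sigma> y)"
    proof (cases "v \<in> Z")
      case True
      then show ?thesis using all_heavy[OF v] Zs Zr by (auto simp: R.heavy_in_def B.heavy_in_def)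
    next
      case False
      then have "v \<in> A" using v by simp
      then show ?thesis using AR AB same_lab[OF _ z, of v] Zs[OF z] Zr[OF z]
        by (auto simp: R.heavy_in_def B.heavy_in_def)
    qed
  qed
qed (use R.finite_heavy_in B.finite_heavy_in R.card_heavy_in B.card_heavy_in in simp_all)

lemma card_le_or_mono_set: "card (A \<union> Z) \<le> 2 * a + 2 * b \<or> mono_set A"
proof (rule disjCI)
  assume nm: "\<not> mono_set A"
  consider x y where "x \<in> A" "x \<notin> B.heavy" "y \<in> A" "y \<notin> R.heavy"
    | y where "A \<subseteq> B.heavy" "y \<in> A" "y \<notin> R.heavy"
    | x where "A \<subseteq> R.heavy" "x \<in> A" "x \<notin> B.heavy"
    | "A \<subseteq> R.heavy" "A \<subseteq> B.heavy" by blast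
  then show "card (A \<union> Z) \<le> 2 * a + 2 * b"
  proof cases
    case 1
    then show ?thesis by (rule card_le_mixed)
  next
    case 2
    then obtain w where "w \<in> A" "\<sigma> w \<noteq> \<sigma> y"
      using nm unfolding mono_set_def B.heavy_in_def by blast
    with 2 show ?thesis by (rule card_le_not_red_heavy)
  next
    case 3
    then obtain w where "w \<in> A" "\<rho> w \<noteq> \<rho> x"
      using nm unfolding mono_set_def R.heavy_in_def by blast
    with 3 show ?thesis by (rule card_le_not_blue_heavy)
  next
    case 4
    have "A \<noteq> {}" using nm by (auto simp: mono_set_def)
    then obtain x where x: "x \<in> A" by blast
    obtain y where y: "y \<in> A" "\<rho> y \<noteq> \<rho> x"
      using nm 4 unfolding mono_set_def R.heavy_in_def by blast
    obtain w where w: "w \<in> A" "\<sigma> w \<noteq> \<sigma> x"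
      using nm 4 unfolding mono_set_def B.heavy_in_def by blast
    show ?thesis by (rule card_le_both_heavy[OF 4 x y w])
  qed
qed

end

lemma card_le_or_mono_set':
  assumes "A \<subseteq> V" "Z \<subseteq> V" "A \<inter> Z = {}" "joined A Z" "a + b < card Z" "Z \<subseteq> R.heavy \<union> B.heavy"
  shows "card A + card Z \<le> 2 * a + 2 * b \<or> mono_set A"
proof -
  have "finite A" "finite Z" using assms R.finite_verts finite_subset by blast+
  then have "card (A \<union> Z) = card A + card Z" using assms by (simp add: card_Un_disjoint)
  then show ?thesis using card_le_or_mono_set[of A Z] assms by metis
qed

text \<open>If both sets were larger, each would make the other heavy, and counting would leave only
  \<open>mono_set A\<close>, which caps \<open>card A\<close> at \<open>b\<close>.\<close>

lemma two_colour_bound: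
  assumes "A \<subseteq> V" "Z \<subseteq> V" "A \<inter> Z = {}" "joined A Z"
  shows "card A \<le> a + b \<or> card Z \<le> a + b"
proof (rule ccontr)
  assume "\<not> ?thesis"
  then have c: "a + b < card A" "a + b < card Z" by auto
  have "Z \<subseteq> R.heavy \<union> B.heavy" by (rule heavy_if_joined[OF assms(2,1) joined_sym[OF assms(4)] c(1)])
  then have "card A + card Z \<le> 2 * a + 2 * b \<or> mono_set A"
    by (rule card_le_or_mono_set'[OF assms c(2)])
  then show False using c card_mono_set[of A] by auto
qed

lemma blue_mono_set:
  "mono_set A \<Longrightarrow> a < card A \<Longrightarrow> \<exists>k. A \<subseteq> B.heavy_in k"
  unfolding mono_set_def
  by (elim disjE) (auto dest: R.card_subset_heavy_in)

text \<open>If both sets exceed \<open>a\<close>, each sits in a blue component. If these coincide,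
  the union has size at most \<open>b\<close>; if not, all edges between the sets are red, and
  \<open>A\<close> would be a red-heavy set of more than \<open>a\<close> vertices in one
  component.\<close>

lemma mono_sets_joined:
  assumes A: "mono_set A" "A \<subseteq> V" and Z: "mono_set Z" "Z \<subseteq> V" and AZ: "joined A Z" "A \<inter> Z = {}"
  shows "card A + card Z \<le> a + b"
proof (cases "a < card A \<and> a < card Z")
  case False
  then show ?thesis using card_mono_set[of A] card_mono_set[of Z] A Z by linarith
next
  case True
  obtain k where k: "A \<subseteq> B.heavy_in k" using blue_mono_set[OF A(1)] True by blast
  obtain j where j: "Z \<subseteq> B.heavy_in j" using blue_mono_set[OF Z(1)] True by blast
  show ?thesis
  proof (cases "j = k")
    case True
    then have "card (A \<union> Z) \<le> b" using k j by (intro B.card_subset_heavy_in[of _ k]) auto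
    moreover have "finite A" "finite Z" using A Z R.finite_verts finite_subset by blast+
    ultimately show ?thesis using AZ by (simp add: card_Un_disjoint)
  next
    case False
    have red: "red x z" if "x \<in> A" "z \<in> Z" for x z
    proof -
      have "x \<in> B.heavy_in k" "z \<in> B.heavy_in j" using that k j by blast+
      then have "\<sigma> x \<noteq> \<sigma> z" using False by (simp add: B.heavy_in_def)
      then show ?thesis using AZ that B.adj_lab[of x z] unfolding joined_def by blast
    qed
    obtain z where z: "z \<in> Z" using True by fastforce
    have "A \<subseteq> R.heavy_in (\<rho> z)"
    proof
      fix x assume x: "x \<in> A"
      have "x \<in> R.heavy" by (rule R.heavyI[of x Z]) (use x A Z True red in auto)
      then show "x \<in> R.heavy_in (\<rho> z)" using R.adj_lab[OF red[OF x z]] by (simp add: R.heavy_in_def)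
    qed
    then show ?thesis using R.card_subset_heavy_in[of A "\<rho> z"] True by linarith
  qed
qed

text \<open>The sizes force \<open>A\<close> and \<open>C\<close> into different blue components, so
  a vertex of \<open>Z\<close> is completely red to one of them. Hence it is red-heavy, in one of
  two red components.\<close>

lemma joined_to_two_mono_sets:
  assumes A: "mono_set A" "A \<subseteq> V" "a < card A" and C: "mono_set C" "C \<subseteq> V" "a < card C"
    and AC: "A \<inter> C = {}" "b < card A + card C"
    and Z: "Z \<subseteq> V" "joined Z A" "joined Z C"
  shows "card Z \<le> 2 * a"
proof -
  obtain k where k: "A \<subseteq> B.heavy_in k" using blue_mono_set[OF A(1,3)] by blast
  obtain j where j: "C \<subseteq> B.heavy_in j" using blue_mono_set[OF C(1,3)] by blast
  have fin: "finite A" "finite C" using A C R.finite_verts finite_subset by blast+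
  have "j \<noteq> k"
  proof
    assume "j = k"
    then have "card (A \<union> C) \<le> b" using k j by (intro B.card_subset_heavy_in[of _ k]) auto
    then show False using AC fin by (simp add: card_Un_disjoint)
  qed
  obtain x y where x: "x \<in> A" and y: "y \<in> C" using A(3) C(3) by fastforce
  have "Z \<subseteq> R.heavy_in (\<rho> x) \<union> R.heavy_in (\<rho> y)"
  proof
    fix z assume z: "z \<in> Z"
    have "(\<forall>v\<in>A. red z v) \<or> (\<forall>v\<in>C. red z v)"
    proof (rule ccontr)
      assume "\<not> ?thesis"
      then obtain u v where uv': "u \<in> A" "v \<in> C" "\<not> red z u" "\<not> red z v" by blast
      then have uv: "u \<in> A" "v \<in> C" "blue z u" "blue z v"
        using Z z unfolding joined_def by blast+
      then have "u \<in> B.heavy_in k" "v \<in> B.heavy_in j" using k j by blast+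
      then show False using \<open>j \<noteq> k\<close> B.adj_lab[OF uv(3)] B.adj_lab[OF uv(4)]
        by (simp add: B.heavy_in_def)
    qed
    then show "z \<in> R.heavy_in (\<rho> x) \<union> R.heavy_in (\<rho> y)"
    proof
      assume r: "\<forall>v\<in>A. red z v"
      have "z \<in> R.heavy" by (rule R.heavyI[of z A]) (use z Z A r in auto)
      then show ?thesis using r x R.adj_lab[of z x] by (auto simp: R.heavy_in_def)
    next
      assume r: "\<forall>v\<in>C. red z v"
      have "z \<in> R.heavy" by (rule R.heavyI[of z C]) (use z Z C r in auto)
      then show ?thesis using r y R.adj_lab[of z y] by (auto simp: R.heavy_in_def)
    qed
  qed
  then have "card Z \<le> card (R.heavy_in (\<rho> x)) + card (R.heavy_in (\<rho> y))"
    using card_le_Un4[of Z "R.heavy_in (\<rho> x)" "R.heavy_in (\<rho> y)" "{}" "{}"] R.finite_heavy_in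
    by simp
  then show ?thesis using R.card_heavy_in[of "\<rho> x"] R.card_heavy_in[of "\<rho> y"] by linarith
qed

section \<open>Two impossible configurations: the path and the hexagon\<close>

text \<open>The complete pairs form the path \<open>U\<close>, \<open>C\<close>, \<open>A\<close>, \<open>D\<close>.\<close>

lemma no_path:
  assumes V: "U \<subseteq> V" "A \<subseteq> V" "C \<subseteq> V" "D \<subseteq> V"
    and disj: "U \<inter> A = {}" "C \<inter> D = {}" "(U \<union> A) \<inter> (C \<union> D) = {}"
    and joined: "joined A C" "joined A D" "joined C U"
    and heavy: "U \<union> D \<subseteq> R.heavy \<union> B.heavy"
    and card: "card U \<le> a + b" "card D \<le> a + b" "a + b < card U + card A" "a + b < card C + card D"
      "3 * a + 3 * b < card U + card A + (card C + card D)"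
  shows False
proof -
  have fin: "finite U" "finite A" "finite C" "finite D"
    using V R.finite_verts finite_subset by blast+
  have UA: "card (U \<union> A) = card U + card A" and CD: "card (C \<union> D) = card C + card D"
    using fin disj by (simp_all add: card_Un_disjoint)
  have jA: "joined A (C \<union> D)" and jC: "joined C (U \<union> A)"
    using joined joined_sym[OF joined(1)] by (auto simp: joined_def)
  have hA: "A \<subseteq> R.heavy \<union> B.heavy" by (rule heavy_if_joined[OF _ _ jA]) (use V card CD in auto)
  have hC: "C \<subseteq> R.heavy \<union> B.heavy" by (rule heavy_if_joined[OF _ _ jC]) (use V card UA in auto)
  \<comment> \<open>Dropping \<open>U\<close> from a total above \<open>3 * a + 3 * b\<close> leaves
    too many vertices for the first alternative.\<close>
  have "card A + card (C \<union> D) \<le> 2 * a + 2 * b \<or> mono_set A"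
    by (rule card_le_or_mono_set'[OF _ _ _ jA]) (use V disj card CD heavy hC in auto)
  then have mA: "mono_set A" using CD card by auto
  have "card C + card (U \<union> A) \<le> 2 * a + 2 * b \<or> mono_set C"
    by (rule card_le_or_mono_set'[OF _ _ _ jC]) (use V disj card UA heavy hA in auto)
  then have mC: "mono_set C" using UA card by auto
  have "card A + card C \<le> a + b"
    by (rule mono_sets_joined[OF mA V(2) mC V(3) joined(1)]) (use disj in auto)
  then show False using card(1,2,5) by simp
qed

text \<open>The complete pairs form a hexagon: \<open>Pi\<close> is joined to \<open>Qj\<close> for \<open>i \<noteq> j\<close>.\<close>

definition hexagon :: "'v set \<Rightarrow> 'v set \<Rightarrow> 'v set \<Rightarrow> 'v set \<Rightarrow> 'v set \<Rightarrow> 'v set \<Rightarrow> bool" where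
  "hexagon P1 P2 P3 Q1 Q2 Q3 \<longleftrightarrow>
    P1 \<subseteq> V \<and> P2 \<subseteq> V \<and> P3 \<subseteq> V \<and> Q1 \<subseteq> V \<and> Q2 \<subseteq> V \<and> Q3 \<subseteq> V \<and>
    P1 \<inter> P2 = {} \<and> P1 \<inter> P3 = {} \<and> P2 \<inter> P3 = {} \<and>
    Q1 \<inter> Q2 = {} \<and> Q1 \<inter> Q3 = {} \<and> Q2 \<inter> Q3 = {} \<and>
    (P1 \<union> P2 \<union> P3) \<inter> (Q1 \<union> Q2 \<union> Q3) = {} \<and>
    joined P1 (Q2 \<union> Q3) \<and> joined P2 (Q1 \<union> Q3) \<and> joined P3 (Q1 \<union> Q2) \<and>
    joined Q1 (P2 \<union> P3) \<and> joined Q2 (P1 \<union> P3) \<and> joined Q3 (P1 \<union> P2) \<and>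
    card P1 \<le> a + b \<and> card P2 \<le> a + b \<and> card P3 \<le> a + b \<and>
    card Q1 \<le> a + b \<and> card Q2 \<le> a + b \<and> card Q3 \<le> a + b \<and>
    2 * a + 2 * b < card P1 + card P2 + card P3 \<and>
    card P1 + card P2 + card P3 = card Q1 + card Q2 + card Q3"

text \<open>Exchanging the sides, or permuting indices on both sides at once, reduces later
  arguments to fixed indices.\<close>

lemma hexagon_swap: "hexagon P1 P2 P3 Q1 Q2 Q3 \<Longrightarrow> hexagon Q1 Q2 Q3 P1 P2 P3"
  unfolding hexagon_def by (elim conjE, intro conjI; (assumption | simp add: Int_commute))

lemma hexagon_perm12: "hexagon P1 P2 P3 Q1 Q2 Q3 \<Longrightarrow> hexagon P2 P1 P3 Q2 Q1 Q3"
  unfolding hexagon_def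
  by (elim conjE, intro conjI; (assumption | simp add: Int_commute Un_ac add_ac))

lemma hexagon_perm23: "hexagon P1 P2 P3 Q1 Q2 Q3 \<Longrightarrow> hexagon P1 P3 P2 Q1 Q3 Q2"
  unfolding hexagon_def
  by (elim conjE, intro conjI; (assumption | simp add: Int_commute Un_ac add_ac))

text \<open>Because \<open>card P2 \<le> a + b\<close>, more than \<open>a + b\<close> vertices
  remain in \<open>P1 \<union> P3\<close>, which is joined to \<open>Q2\<close>.\<close>

lemma hexagon_heavy2:
  assumes "hexagon P1 P2 P3 Q1 Q2 Q3"
  shows "Q2 \<subseteq> R.heavy \<union> B.heavy"
proof -
  have "P1 \<subseteq> V" "P3 \<subseteq> V" using assms unfolding hexagon_def by (elim conjE, simp)+
  then have fin: "finite P1" "finite P3" by (simp_all add: finite_subset[OF _ R.finite_verts])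
  have h: "Q2 \<subseteq> V" "P1 \<union> P3 \<subseteq> V" "joined Q2 (P1 \<union> P3)" "P1 \<inter> P3 = {}"
    "card P2 \<le> a + b" "2 * a + 2 * b < card P1 + card P2 + card P3"
    using assms unfolding hexagon_def by (elim conjE, simp)+
  have "a + b < card (P1 \<union> P3)" using h fin by (simp add: card_Un_disjoint)
  then show ?thesis by (rule heavy_if_joined[OF h(1-3)])
qed

text \<open>If \<open>P1\<close> is at least as large as \<open>Q1\<close>, then \<open>P1\<close>,
  \<open>Q2\<close>, \<open>Q3\<close> together exceed \<open>2 * a + 2 * b\<close>, and counting
  leaves only the second alternative.\<close>

lemma hexagon_less_or_mono1:
  assumes "hexagon P1 P2 P3 Q1 Q2 Q3"
  shows "card P1 < card Q1 \<or> mono_set P1"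
proof -
  have V: "P1 \<subseteq> V" "Q2 \<subseteq> V" "Q3 \<subseteq> V" and j: "joined P1 (Q2 \<union> Q3)"
    and d: "(P1 \<union> P2 \<union> P3) \<inter> (Q1 \<union> Q2 \<union> Q3) = {}"
    using assms unfolding hexagon_def by (elim conjE, simp)+
  have fin: "finite Q2" "finite Q3" using V by (simp_all add: finite_subset[OF _ R.finite_verts])
  have h: "P1 \<subseteq> V" "Q2 \<union> Q3 \<subseteq> V" "P1 \<inter> (Q2 \<union> Q3) = {}" using V d by blast+
  have n: "card Q1 \<le> a + b" "2 * a + 2 * b < card Q1 + card Q2 + card Q3" "Q2 \<inter> Q3 = {}"
    using assms unfolding hexagon_def by (elim conjE, simp)+
  have c: "card (Q2 \<union> Q3) = card Q2 + card Q3" using n fin by (simp add: card_Un_disjoint)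
  have "card P1 + card (Q2 \<union> Q3) \<le> 2 * a + 2 * b \<or> mono_set P1"
  proof (rule card_le_or_mono_set'[OF h j])
    show "a + b < card (Q2 \<union> Q3)" using c n by linarith
    show "Q2 \<union> Q3 \<subseteq> R.heavy \<union> B.heavy"
      using hexagon_heavy2[OF assms] hexagon_heavy2[OF hexagon_perm23[OF assms]] by blast
  qed
  then show ?thesis using c n by auto
qed

lemma hexagon_le_if_mono12:
  assumes h: "hexagon P1 P2 P3 Q1 Q2 Q3" and m: "mono_set P1" "mono_set P2"
    and c: "a < card P1" "a < card P2" "b < card P1 + card P2"
  shows "card Q3 \<le> 2 * a"
proof -
  have "P1 \<subseteq> V" "P2 \<subseteq> V" "P1 \<inter> P2 = {}" "Q3 \<subseteq> V" and j: "joined Q3 (P1 \<union> P2)"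
    using h unfolding hexagon_def by (elim conjE, simp)+
  moreover have "joined Q3 P1" "joined Q3 P2" using j by (auto simp: joined_def)
  ultimately show ?thesis using joined_to_two_mono_sets[of P1 P2 Q3] m c by blast
qed

lemma hexagon_mono12:
  assumes h: "hexagon P1 P2 P3 Q1 Q2 Q3" and m: "mono_set P1" "mono_set P2"
    and m3: "mono_set P3 \<or> mono_set Q3 \<and> card P3 < card Q3"
  shows False
proof -
  have n: "2 * a + 2 * b < card P1 + card P2 + card P3"
    "card P1 + card P2 + card P3 = card Q1 + card Q2 + card Q3"
    using h unfolding hexagon_def by (elim conjE, simp)+
  note b = card_mono_set[OF m(1)] card_mono_set[OF m(2)]
  have "card P3 \<le> b" using m3 card_mono_set by fastforce
  then have c: "a < card P1" "a < card P2" "b < card P1 + card P2" using n b by linarith+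
  have q3: "card Q3 \<le> 2 * a" by (rule hexagon_le_if_mono12[OF h m c])
  show False
  proof (cases "mono_set P3")
    case False
    \<comment> \<open>Here \<open>card P3 < card Q3 \<le> 2 * a\<close>, so the total falls below
      \<open>2 * a + 2 * b\<close>.\<close>
    then show ?thesis using m3 q3 n b by auto
  next
    case True
    note b3 = card_mono_set[OF True]
    note h2 = hexagon_perm23[OF h]
    have "card Q2 \<le> 2 * a" by (rule hexagon_le_if_mono12[OF h2 m(1) True]) (use n b b3 in linarith)+
    moreover have "card Q1 \<le> 2 * a"
      by (rule hexagon_le_if_mono12[OF hexagon_perm23[OF hexagon_perm12[OF h]] m(2) True])
        (use n b b3 in linarith)+
    \<comment> \<open>The total is at most \<open>3 * b\<close> and at most \<open>6 * a\<close>;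
      exceeding \<open>2 * a + 2 * b\<close>, it would force both \<open>b > 2 * a\<close> and
      \<open>b < 2 * a\<close>.\<close>
    ultimately show False using q3 n b b3 by linarith
  qed
qed

lemma no_hexagon: "\<not> hexagon P1 P2 P3 Q1 Q2 Q3"
proof
  assume h: "hexagon P1 P2 P3 Q1 Q2 Q3"
  note h2 = hexagon_perm12[OF h]
  note h3 = hexagon_perm12[OF hexagon_perm23[OF h]]
  note g = hexagon_swap[OF h] hexagon_swap[OF h2] hexagon_swap[OF h3]
  note P = hexagon_less_or_mono1[OF h] hexagon_less_or_mono1[OF h2] hexagon_less_or_mono1[OF h3]
  note Q = hexagon_less_or_mono1[OF g(1)] hexagon_less_or_mono1[OF g(2)] hexagon_less_or_mono1[OF g(3)]
  have P': "mono_set S \<or> mono_set T \<and> card S < card T"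
    if "card S < card T \<or> mono_set S" "card T < card S \<or> mono_set T" for S T
    using that by auto
  note k = h hexagon_perm23[OF h] hexagon_perm23[OF h2]
  have *: False if "hexagon S1 S2 S3 T1 T2 T3" "mono_set S1" "mono_set S2"
      "card S3 < card T3 \<or> mono_set S3" "card T3 < card S3 \<or> mono_set T3" for S1 S2 S3 T1 T2 T3
    by (rule hexagon_mono12[OF that(1-3) P'[OF that(4,5)]])
  \<comment> \<open>\<open>Pi\<close> and \<open>Qi\<close> cannot each be smaller than the other,
    so one of them is a \<open>mono_set\<close>; two of the three found lie on the same
    side.\<close>
  consider "mono_set P1" "mono_set P2" | "mono_set P1" "mono_set P3" | "mono_set P2" "mono_set P3"
    | "mono_set Q1" "mono_set Q2" | "mono_set Q1" "mono_set Q3" | "mono_set Q2" "mono_set Q3"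
    using P Q by (meson less_asym)
  then show False
  proof cases
    case 1 show ?thesis by (rule *[OF k(1) 1 P(3) Q(3)])
  next
    case 2 show ?thesis by (rule *[OF k(2) 2 P(2) Q(2)])
  next
    case 3 show ?thesis by (rule *[OF k(3) 3 P(1) Q(1)])
  next
    case 4 show ?thesis by (rule *[OF hexagon_swap[OF k(1)] 4 Q(3) P(3)])
  next
    case 5 show ?thesis by (rule *[OF hexagon_swap[OF k(2)] 5 Q(2) P(2)])
  next
    case 6 show ?thesis by (rule *[OF hexagon_swap[OF k(3)] 6 Q(1) P(1)])
  qed
qed

end

section \<open>Three colours: grouping the green components\<close>

locale three_covered_graphs =
  two_covered_graphs V red blue \<rho> \<sigma> a b + G: covered_graph V green \<gamma> c
  for V :: "'v set" and red blue green :: "'v \<Rightarrow> 'v \<Rightarrow> bool" and \<rho> \<sigma> \<gamma> :: "'v \<Rightarrow> 'k"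
    and a b c :: nat +
  fixes X Y :: "'v set"
  assumes V_eq: "V = X \<union> Y" and XY: "X \<inter> Y = {}"
    and card_X: "card X = a + b + c + 1" and card_Y: "card Y = a + b + c + 1"
    and c_ge: "a + b \<le> c"
    and total: "x \<in> X \<Longrightarrow> y \<in> Y \<Longrightarrow> red x y \<or> blue x y \<or> green x y"
begin

definition part :: "'v set \<Rightarrow> 'k set \<Rightarrow> 'v set" where
  "part S K = {v \<in> S. \<gamma> v \<in> K}"

definition small :: "'k set \<Rightarrow> bool" where
  "small K \<longleftrightarrow> card (part X K) \<le> a + b \<and> card (part Y K) \<le> a + b"

lemma part_subset: "part X K \<subseteq> V" "part Y K \<subseteq> V" "part X K \<subseteq> X" "part Y K \<subseteq> Y"
  by (auto simp: part_def V_eq)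

lemma finite_part: "finite (part X K)" "finite (part Y K)"
  by (rule finite_subset[OF part_subset(1) R.finite_verts],
      rule finite_subset[OF part_subset(2) R.finite_verts])

lemma part_Un: "part S K \<union> part S L = part S (K \<union> L)" by (auto simp: part_def)

lemma part_disjoint: "K \<inter> L = {} \<Longrightarrow> part S K \<inter> part S L = {}" by (auto simp: part_def)

lemma card_part_Un:
  "K \<inter> L = {} \<Longrightarrow> card (part X (K \<union> L)) = card (part X K) + card (part X L)"
  "K \<inter> L = {} \<Longrightarrow> card (part Y (K \<union> L)) = card (part Y K) + card (part Y L)"
  unfolding part_Un[symmetric] by (simp_all add: card_Un_disjoint finite_part part_disjoint)

lemma card_part_UNIV: "card (part X UNIV) = a + b + c + 1" "card (part Y UNIV) = a + b + c + 1"
  using card_X card_Y by (simp_all add: part_def)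

lemma card_part_Compl:
  "card (part X K) + card (part X (- K)) = a + b + c + 1"
  "card (part Y K) + card (part Y (- K)) = a + b + c + 1"
  using card_part_Un[of K "- K"] card_part_UNIV by simp_all

lemma joined_if_not_green:
  assumes "A \<subseteq> X" "Z \<subseteq> Y" "\<And>x z. x \<in> A \<Longrightarrow> z \<in> Z \<Longrightarrow> \<not> green x z"
  shows "joined A Z"
  unfolding joined_def
proof (intro ballI)
  fix x z assume "x \<in> A" "z \<in> Z"
  then show "red x z \<or> blue x z" using total[of x z] assms(3)[of x z] assms(1,2) by blast
qed

lemma joined_parts:
  assumes "K \<inter> L = {}"
  shows "joined (part X K) (part Y L)" "joined (part Y L) (part X K)"
proof -
  show "joined (part X K) (part Y L)"
  proof (rule joined_if_not_green)
    fix x z assume "x \<in> part X K" "z \<in> part Y L"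
    then show "\<not> green x z" using G.adj_lab[of x z] assms by (auto simp: part_def)
  qed (rule part_subset)+
  then show "joined (part Y L) (part X K)" by (rule joined_sym)
qed

text \<open>The two-colour bound applies to both crossing pairs of parts. A side has more than
  \<open>2 * (a + b)\<close> vertices, so its two parts cannot both be bounded; the bounded ones
  belong to the same label set.\<close>

lemma small_or_small_Compl: "small K \<or> small (- K)"
proof -
  have "card (part X K) \<le> a + b \<or> card (part Y (- K)) \<le> a + b"
    by (rule two_colour_bound[OF part_subset(1,2) _ joined_parts(1)]) (use XY in \<open>auto simp: part_def\<close>)
  moreover have "card (part X (- K)) \<le> a + b \<or> card (part Y K) \<le> a + b"
    by (rule two_colour_bound[OF part_subset(1,2) _ joined_parts(1)]) (use XY in \<open>auto simp: part_def\<close>)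
  ultimately show ?thesis
    using card_part_Compl[of K] c_ge unfolding small_def by linarith
qed

lemma not_small_Compl_singleton: "\<not> small (- {k})"
proof
  assume small: "small (- {k})"
  obtain W where W: "finite W" "card W \<le> c"
    and cov: "\<forall>u\<in>V. \<forall>v\<in>V. green u v \<longrightarrow> \<gamma> u = k \<longrightarrow> u \<in> W \<or> v \<in> W"
    using G.cover[of k] by (elim exE conjE) (rule that)
  let ?U = "part X (- {k})" and ?D = "part Y (- {k})"
  define A where "A = part X {k} - W"
  define C where "C = part Y {k} - W"
  have AC: "A \<subseteq> part X {k}" "C \<subseteq> part Y {k}" by (auto simp: A_def C_def)
  have "card (part X {k} \<inter> W) + card (part Y {k} \<inter> W) = card ((part X {k} \<inter> W) \<union> (part Y {k} \<inter> W))"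
    by (rule card_Un_disjoint[symmetric]) (use W(1) XY in \<open>auto simp: part_def\<close>)
  also have "\<dots> \<le> card W" by (rule card_mono) (use W(1) in auto)
  finally have ST: "card (part X {k} \<inter> W) + card (part Y {k} \<inter> W) \<le> c" using W(2) by linarith
  have cA: "card A + card (part X {k} \<inter> W) = card (part X {k})"
    unfolding A_def using finite_part(1)[of "{k}"] card_Int_Diff by (metis add.commute)
  have cC: "card C + card (part Y {k} \<inter> W) = card (part Y {k})"
    unfolding C_def using finite_part(2)[of "{k}"] card_Int_Diff by (metis add.commute)
  have "card ?U \<le> a + b" "card ?D \<le> a + b" using small by (simp_all add: small_def)
  \<comment> \<open>Removing at most \<open>c\<close> of the \<open>2 * (a + b + c + 1)\<close>
    vertices leaves more than \<open>3 * a + 3 * b\<close>, by \<open>c_ge\<close>.\<close>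
  note card = this card_part_Compl[of "{k}"] ST cA cC c_ge
  have jAC: "joined A C"
  proof (rule joined_if_not_green)
    fix x z assume "x \<in> A" "z \<in> C"
    then have "x \<in> V" "z \<in> V" "\<gamma> x = k" "x \<notin> W" "z \<notin> W"
      using part_subset by (auto simp: A_def C_def part_def V_eq)
    then show "\<not> green x z" using bspec[OF bspec[OF cov], of x z] by simp
  qed (use AC part_subset in \<open>auto simp: part_def\<close>)
  have jAD: "joined A ?D"
    using joined_parts(1)[of "{k}" "- {k}"] AC(1) unfolding joined_def by auto
  have jCU: "joined C ?U"
    using joined_parts(2)[of "- {k}" "{k}"] AC(2) unfolding joined_def by auto
  have "?U \<subseteq> R.heavy \<union> B.heavy"
    by (rule heavy_if_joined[OF part_subset(1,2) joined_parts(1)[of "- {k}" "{k}"]]) (use card in auto)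
  moreover have "?D \<subseteq> R.heavy \<union> B.heavy"
    by (rule heavy_if_joined[OF part_subset(2,1) joined_parts(2)[of "{k}" "- {k}"]]) (use card in auto)
  ultimately have heavy: "?U \<union> ?D \<subseteq> R.heavy \<union> B.heavy" by simp
  show False
  proof (rule no_path[OF part_subset(1) _ _ part_subset(2) _ _ _ jAC jAD jCU heavy])
    show "A \<subseteq> V" "C \<subseteq> V" using AC part_subset(1,2) by blast+
    show "?U \<inter> A = {}" "C \<inter> ?D = {}" by (auto simp: A_def C_def part_def)
    show "(?U \<union> A) \<inter> (C \<union> ?D) = {}" using XY by (auto simp: A_def C_def part_def)
  qed (use card in linarith)+
qed

lemma impossible: False
proof -
  have small1: "small {k}" for k
    using small_or_small_Compl[of "{k}"] not_small_Compl_singleton[of k] by blast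
  \<comment> \<open>Labels are added one at a time: the empty set is small and the set of all labels
    is not, so some \<open>k\<close> destroys smallness.\<close>
  have "small F \<or> (\<exists>K k. small K \<and> \<not> small (insert k K))" if "finite F" for F
    using that
  proof (induction F rule: finite_induct)
    case empty
    show ?case by (simp add: small_def part_def)
  next
    case (insert k F)
    then show ?case by blast
  qed
  moreover have "\<not> small (\<gamma> ` V)"
  proof -
    have "part X (\<gamma> ` V) = X" by (auto simp: part_def V_eq)
    then show ?thesis using card_X c_ge by (simp add: small_def)
  qed
  moreover have "finite (\<gamma> ` V)" using R.finite_verts by simp
  ultimately obtain K k where K: "small K" "\<not> small (insert k K)" by blast
  have kK: "k \<notin> K" using K by (metis insert_absorb)
  let ?L = "- insert k K"
  have L: "small ?L" using small_or_small_Compl[of "insert k K"] K by blast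
  have "hexagon (part X K) (part X {k}) (part X ?L) (part Y K) (part Y {k}) (part Y ?L)"
    unfolding hexagon_def part_Un
  proof (intro conjI)
    have u: "K \<union> {k} \<union> ?L = UNIV" "(K \<union> {k}) \<inter> ?L = {}" "K \<inter> {k} = {}" using kK by auto
    have X: "card (part X K) + card (part X {k}) + card (part X ?L) = a + b + c + 1"
      using card_part_Un(1)[OF u(2)] card_part_Un(1)[OF u(3)] card_part_UNIV(1) unfolding u(1) by simp
    have Y: "card (part Y K) + card (part Y {k}) + card (part Y ?L) = a + b + c + 1"
      using card_part_Un(2)[OF u(2)] card_part_Un(2)[OF u(3)] card_part_UNIV(2) unfolding u(1) by simp
    show "2 * a + 2 * b < card (part X K) + card (part X {k}) + card (part X ?L)"
      using X c_ge by linarith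
    show "card (part X K) + card (part X {k}) + card (part X ?L) =
      card (part Y K) + card (part Y {k}) + card (part Y ?L)" using X Y by simp
  qed ((rule part_subset part_disjoint joined_parts; use kK in \<open>auto; fail\<close>)
    | (use K(1) L small1[of k] in \<open>simp add: small_def; fail\<close>)
    | (use XY in \<open>auto simp: part_def; fail\<close>) | (rule part_subset))+
  then show False using no_hexagon by blast
qed

end

section \<open>Matchings and components of a colour class\<close>

lemma finite_knn_edges: "finite (knn_edges n)"
proof -
  have "knn_edges n \<subseteq> Pow (Inl ` {..<n} \<union> Inr ` {..<n})" by (auto simp: knn_edges_def)
  then show ?thesis by (rule finite_subset) simp
qed

lemma finite_colour_class: "finite (colour_class n c x)"
  using finite_knn_edges by (simp add: colour_class_def)

lemma matching_le_max_matching_size: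
  assumes "finite E" "is_matching E M"
  shows "card M \<le> max_matching_size E"
proof -
  have "{card M | M. is_matching E M} \<subseteq> card ` Pow E" by (auto simp: is_matching_def)
  then have "finite {card M | M. is_matching E M}" by (rule finite_subset) (use assms in simp)
  then show ?thesis unfolding max_matching_size_def by (rule Max_ge) (use assms in auto)
qed

lemma max_matching_size_attained:
  assumes "finite E"
  obtains M where "is_matching E M" "card M = max_matching_size E"
proof -
  have "{card M | M. is_matching E M} \<subseteq> card ` Pow E" by (auto simp: is_matching_def)
  then have "finite {card M | M. is_matching E M}" by (rule finite_subset) (use assms in simp)
  moreover have "is_matching E {}" by (simp add: is_matching_def)
  then have "{card M | M. is_matching E M} \<noteq> {}" by blast
  ultimately have "max_matching_size E \<in> {card M | M. is_matching E M}"
    unfolding max_matching_size_def by (rule Max_in)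
  then show ?thesis using that by auto
qed

text \<open>The component itself, as a vertex set, serves as the label \<open>lab\<close> of its
  vertices.\<close>

definition component_of :: "'v set set \<Rightarrow> 'v \<Rightarrow> 'v set" where
  "component_of E u = {v. (u, v) \<in> (adjacency E)\<^sup>*}"

lemma component_of_eq:
  assumes "{u, v} \<in> E"
  shows "component_of E u = component_of E v"
proof -
  have "(u, v) \<in> (adjacency E)\<^sup>*" using assms by (auto simp: adjacency_def)
  moreover have "(v, u) \<in> (adjacency E)\<^sup>*"
    using assms by (auto simp: adjacency_def insert_commute)
  ultimately show ?thesis unfolding component_of_def by (auto intro: rtrancl_trans)
qed

lemma component_of_in_components:
  assumes "u \<in> V" "\<And>e. e \<in> E \<Longrightarrow> e \<subseteq> V"
  shows "component_of E u \<in> components V E"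
proof -
  have "v \<in> V" if "(u, v) \<in> (adjacency E)\<^sup>*" for v
    using that
  proof (induction rule: rtrancl_induct)
    case base
    show ?case by (rule assms(1))
  next
    case (step y z)
    then have "{y, z} \<in> E" by (simp add: adjacency_def)
    then show ?case using assms(2)[of "{y, z}"] by simp
  qed
  then have "component_of E u = {(u, v). u \<in> V \<and> v \<in> V \<and> (u, v) \<in> (adjacency E)\<^sup>*} `` {u}"
    using assms(1) by (auto simp: component_of_def)
  then show ?thesis unfolding components_def by (simp only: quotientI[OF assms(1)])
qed

text \<open>Koenig's theorem with \<open>t = Suc s\<close>, applied in each component, turns the
  bound on matchings into a cover.\<close>

lemma covered_colour_class:
  assumes "\<not> has_mono_connected_matching n c x (Suc s)"
  shows "covered_graph (knn_verts n) (\<lambda>u v. {u, v} \<in> colour_class n c x)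
    (component_of (colour_class n c x)) s"
proof
  let ?E = "colour_class n c x"
  show "finite (knn_verts n)" by (simp add: knn_verts_def)
  show "{v, u} \<in> ?E" if "{u, v} \<in> ?E" for u v using that by (simp add: insert_commute)
  show "component_of ?E u = component_of ?E v" if "{u, v} \<in> ?E" for u v
    using that by (rule component_of_eq)
  fix k
  show "\<exists>W. finite W \<and> card W \<le> s \<and> (\<forall>u\<in>knn_verts n. \<forall>v\<in>knn_verts n.
    {u, v} \<in> ?E \<longrightarrow> component_of ?E u = k \<longrightarrow> u \<in> W \<or> v \<in> W)"
  proof (cases "\<exists>u\<in>knn_verts n. component_of ?E u = k")
    case False
    \<comment> \<open>A label of no vertex imposes no condition.\<close>
    then show ?thesis by (intro exI[of _ "{}"]) auto
  next
    case True
    have sub: "e \<subseteq> knn_verts n" if "e \<in> ?E" for e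
      using that by (auto simp: colour_class_def knn_edges_def knn_verts_def)
    have k: "k \<in> components (knn_verts n) ?E"
      using True component_of_in_components[OF _ sub] by blast
    let ?F = "component_edges ?E k"
    have fin: "finite ?F" using finite_colour_class by (simp add: component_edges_def)
    have "\<not> Suc s \<le> max_matching_size ?F"
      using assms k unfolding has_mono_connected_matching_def is_connected_matching_def by blast
    then have small: "\<not> (\<exists>M. is_matching ?F M \<and> Suc s \<le> card M)"
      using matching_le_max_matching_size[OF fin] le_trans by blast
    have "\<exists>W. finite W \<and> (\<forall>e\<in>?F. e \<inter> W \<noteq> {}) \<and> card W \<le> s"
    proof (rule ccontr)
      assume *: "\<not> ?thesis"
      have "\<exists>M. is_matching ?F M \<and> Suc s \<le> card M"
      proof (rule koenig[OF fin, of "range Inl"])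
        show "\<exists>x y. e = {x, y} \<and> x \<in> range Inl \<and> y \<notin> range Inl" if "e \<in> ?F" for e
          using that by (auto simp: component_edges_def colour_class_def knn_edges_def)
        show "Suc s \<le> card W" if "finite W" "\<And>e. e \<in> ?F \<Longrightarrow> e \<inter> W \<noteq> {}" for W
          using * that by (meson not_less_eq_eq)
      qed
      then show False using small by simp
    qed
    then obtain W where W: "finite W" "\<forall>e\<in>?F. e \<inter> W \<noteq> {}" "card W \<le> s"
      by (elim exE conjE)
    have "u \<in> W \<or> v \<in> W" if uv: "{u, v} \<in> ?E" "component_of ?E u = k" for u v
    proof -
      have "u \<in> component_of ?E u" "v \<in> component_of ?E v" by (auto simp: component_of_def)
      then have "{u, v} \<in> ?F" using uv component_of_eq[OF uv(1)] by (simp add: component_edges_def)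
      then show ?thesis using bspec[OF W(2), of "{u, v}"] by simp
    qed
    then show ?thesis using W by (intro exI[of _ W]) simp
  qed
qed

section \<open>The upper bound for the Ramsey number\<close>

lemma has_mono_connected_matching_upper:
  fixes a b c :: nat
  assumes "a \<le> b" "a + b \<le> c"
  shows "has_mono_connected_matching (a + b + c + 1) col Red (Suc a) \<or>
    has_mono_connected_matching (a + b + c + 1) col Blue (Suc b) \<or>
    has_mono_connected_matching (a + b + c + 1) col Green (Suc c)"
proof (rule ccontr)
  let ?n = "a + b + c + 1"
  assume "\<not> ?thesis"
  then have no: "\<not> has_mono_connected_matching ?n col Red (Suc a)"
    "\<not> has_mono_connected_matching ?n col Blue (Suc b)"
    "\<not> has_mono_connected_matching ?n col Green (Suc c)" by simp_all
  interpret R: covered_graph "knn_verts ?n" "\<lambda>u v. {u, v} \<in> colour_class ?n col Red"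
    "component_of (colour_class ?n col Red)" a by (rule covered_colour_class[OF no(1)])
  interpret B: covered_graph "knn_verts ?n" "\<lambda>u v. {u, v} \<in> colour_class ?n col Blue"
    "component_of (colour_class ?n col Blue)" b by (rule covered_colour_class[OF no(2)])
  interpret G: covered_graph "knn_verts ?n" "\<lambda>u v. {u, v} \<in> colour_class ?n col Green"
    "component_of (colour_class ?n col Green)" c by (rule covered_colour_class[OF no(3)])
  interpret three_covered_graphs "knn_verts ?n" "\<lambda>u v. {u, v} \<in> colour_class ?n col Red"
    "\<lambda>u v. {u, v} \<in> colour_class ?n col Blue" "\<lambda>u v. {u, v} \<in> colour_class ?n col Green"
    "component_of (colour_class ?n col Red)" "component_of (colour_class ?n col Blue)"
    "component_of (colour_class ?n col Green)" a b c "Inl ` {..<?n}" "Inr ` {..<?n}"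
  proof
    show "{x, y} \<in> colour_class ?n col Red \<or> {x, y} \<in> colour_class ?n col Blue \<or>
      {x, y} \<in> colour_class ?n col Green" if "x \<in> Inl ` {..<?n}" "y \<in> Inr ` {..<?n}" for x y
    proof -
      have "{x, y} \<in> knn_edges ?n" using that by (auto simp: knn_edges_def)
      then show ?thesis by (cases "col {x, y}") (auto simp: colour_class_def)
    qed
  qed (use assms in \<open>auto simp: knn_verts_def card_image\<close>)
  show False by (rule impossible)
qed

section \<open>The lower bound for the Ramsey number\<close>

text \<open>Disjoint edges of colour \<open>x\<close> have distinct left ends, all in
  \<open>S\<close>, so a matching injects into \<open>S\<close>.\<close>

lemma no_mono_connected_matching:
  assumes "\<And>i j. i < n \<Longrightarrow> j < n \<Longrightarrow> col {Inl i, Inr j} = x \<Longrightarrow> i \<in> S"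
    and "finite S" "card S < t"
  shows "\<not> has_mono_connected_matching n col x t"
proof
  assume "has_mono_connected_matching n col x t"
  then obtain C where C: "t \<le> max_matching_size (component_edges (colour_class n col x) C)"
    by (auto simp: has_mono_connected_matching_def is_connected_matching_def)
  let ?F = "component_edges (colour_class n col x) C"
  have fin: "finite ?F" using finite_colour_class by (simp add: component_edges_def)
  obtain M where M: "is_matching ?F M" "card M = max_matching_size ?F"
    using max_matching_size_attained[OF fin] .
  have "\<forall>e\<in>M. \<exists>i\<in>S. Inl i \<in> e"
  proof
    fix e assume "e \<in> M"
    then have "e \<in> colour_class n col x" using M by (auto simp: is_matching_def component_edges_def)
    then obtain i j where "e = {Inl i, Inr j}" "i < n" "j < n" "col e = x"
      by (auto simp: colour_class_def knn_edges_def)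
    then show "\<exists>i\<in>S. Inl i \<in> e" using assms(1)[of i j] by auto
  qed
  then obtain f where f: "\<forall>e\<in>M. f e \<in> S \<and> Inl (f e) \<in> e" by metis
  have "inj_on f M"
  proof (rule inj_onI, rule ccontr)
    fix d e assume de: "d \<in> M" "e \<in> M" "f d = f e" "d \<noteq> e"
    then have "d \<inter> e = {}" using M(1) by (simp add: is_matching_def)
    moreover have "Inl (f d) \<in> d" "Inl (f d) \<in> e" using f de by auto
    ultimately show False by blast
  qed
  moreover have "f ` M \<subseteq> S" using f by auto
  ultimately have "card M \<le> card S" using assms(2) by (rule card_inj_on_le)
  then show False using M(2) C assms(3) by linarith
qed

text \<open>The extremal colouring: an edge gets its colour from its left end, where \<open>a\<close> vertices are red,
  \<open>b\<close> are blue, and the remaining ones, at most \<open>c\<close>, are green.\<close>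

lemma has_mono_connected_matching_lower:
  fixes a b c :: nat
  assumes "n \<le> a + b + c"
  shows "\<exists>col. \<not> has_mono_connected_matching n col Red (Suc a) \<and>
    \<not> has_mono_connected_matching n col Blue (Suc b) \<and>
    \<not> has_mono_connected_matching n col Green (Suc c)"
proof -
  define col :: "(nat + nat) set \<Rightarrow> colour" where
    "col e = (if \<exists>i<a. Inl i \<in> e then Red else if \<exists>i<a + b. Inl i \<in> e then Blue else Green)" for e
  have col: "col {Inl i, Inr j} = (if i < a then Red else if i < a + b then Blue else Green)" for i j
    by (auto simp: col_def)
  have "\<not> has_mono_connected_matching n col Red (Suc a)"
    by (rule no_mono_connected_matching[where S = "{..<a}"]) (auto simp: col split: if_splits)
  moreover have "\<not> has_mono_connected_matching n col Blue (Suc b)"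
    by (rule no_mono_connected_matching[where S = "{a..<a + b}"]) (auto simp: col split: if_splits)
  moreover have "\<not> has_mono_connected_matching n col Green (Suc c)"
    by (rule no_mono_connected_matching[where S = "{a + b..<n}"])
      (use assms in \<open>auto simp: col split: if_splits\<close>)
  ultimately show ?thesis by blast
qed

theorem theorem4p3:
  fixes k l m :: nat
  assumes "2 \<le> k" and "k < l" and "m \<ge> k + l - 1"
  shows "ramsey_connected_matching k l m = k + l + m - 2"
proof -
  define a b c where "a = k - 1" "b = l - 1" "c = m - 1"
  have klm: "k = Suc a" "l = Suc b" "m = Suc c" using assms by (auto simp: a_b_c_def)
  have abc: "a \<le> b" "a + b \<le> c" using assms klm by auto
  have "ramsey_connected_matching (Suc a) (Suc b) (Suc c) = a + b + c + 1"
    unfolding ramsey_connected_matching_def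
  proof (rule Least_equality)
    show "\<forall>col. has_mono_connected_matching (a + b + c + 1) col Red (Suc a) \<or>
      has_mono_connected_matching (a + b + c + 1) col Blue (Suc b) \<or>
      has_mono_connected_matching (a + b + c + 1) col Green (Suc c)"
      using has_mono_connected_matching_upper[OF abc] by (rule allI)
  next
    fix n
    assume n: "\<forall>col. has_mono_connected_matching n col Red (Suc a) \<or>
      has_mono_connected_matching n col Blue (Suc b) \<or> has_mono_connected_matching n col Green (Suc c)"
    show "a + b + c + 1 \<le> n"
    proof (rule ccontr)
      assume "\<not> a + b + c + 1 \<le> n"
      then have "n \<le> a + b + c" by simp
      then show False using has_mono_connected_matching_lower[of n a b c] n by blast
    qed
  qed
  then show ?thesis by (simp add: klm)
qed

end
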